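(* Let $\Omega=(0,1)^3$, fix $i\in\{1,2,3\}$, let $\{j,k\}=\{1,2,3\}\setminus\{i\}$, and consider a no-slip solid wall at $x_i=0$ for a smooth solution (with positive density and temperature) of the Eulerian model with $\nu=\alpha\mu/\rho$. Suppose that at the wall the boundary conditions $$\mu\,\frac{1}{\mathcal T}\frac{\partial\mathcal T}{\partial x_i}=g(t)\qquad\text{and}\qquad\frac1\rho\frac{\partial\rho}{\partial x_i}=0$$ are imposed, where $g$ is given data. Then these boundary conditions bound the viscous contribution of the wall to the time derivative of the entropy function $\mathcal S=-\rho s$; that is, the quantity $$-\int_{x_i=0}w^\top\left(\nu\frac{dq}{dw}\right)\frac{\partial w}{\partial x_i}\,dx_j\,dx_k\qquad(\text{no sum over } i)$$ is bounded by data: there is a constant $C$ depending only on $\alpha$ and the gas constants such that its absolute value is at most $C\int_{x_i=0}|g|\,dx_j\,dx_k$ at each time $t$.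
   Context: The Eulerian model (repeated indices summed over $1,2,3$): with conservative variables $q=(\rho,\rho\mathcal U_1,\rho\mathcal U_2,\rho\mathcal U_3,\rho\mathcal E)^\top$, $$\partial_t\rho+\partial_{x_j}(\rho\mathcal U_j)=\partial_{x_j}(\nu\,\partial_{x_j}\rho),\quad \partial_t(\rho\mathcal U_l)+\partial_{x_j}(\rho\mathcal U_l\mathcal U_j)+\partial_{x_l}p=\partial_{x_j}(\nu\,\partial_{x_j}(\rho\mathcal U_l)),$$ $$\partial_t(\rho\mathcal E)+\partial_{x_j}(\rho\mathcal E\,\mathcal U_j)+\partial_{x_j}(p\,\mathcal U_j)=\partial_{x_j}(\nu\,\partial_{x_j}(\rho\mathcal E)).$$ Here $\rho$ is density, $\mathcal U$ velocity, $\mathcal T$ temperature, $p=\rho R\mathcal T$, $\mathcal E=c_v\mathcal T+\frac12\mathcal U_l\mathcal U_l$, with constants $c_v>0$, $R=c_p-c_v>0$, and $\nu=\alpha\mu/\rho$ with dynamic viscosity $\mu>0$ and $\alpha\in[1,\frac43]$. Entropy: $\mathcal S=-\rho s$, $\mathcal F_i=-\rho\,\mathcal U_i s$, where $s=c_v\ln\mathcal T-R\ln\rho$ (up to an additive constant) is the thermodynamic entropy. The entropy variables are $w=\left(\frac{d\mathcal S}{dq}\right)^\top=\left(\frac{h}{\mathcal T}-s-\frac{\mathcal U_l\mathcal U_l}{2\mathcal T},\frac{\mathcal U_1}{\mathcal T},\frac{\mathcal U_2}{\mathcal T},\frac{\mathcal U_3}{\mathcal T},-\frac1{\mathcal T}\right)^\top$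 with enthalpy $h=c_p\mathcal T$, and $\frac{dq}{dw}$ is the Jacobian of $q$ as a function of $w$. No-slip wall: $\mathcal U_i=0$ and $\mathcal U_j=\mathcal U_j^{\text{wall}}$, $\mathcal U_k=\mathcal U_k^{\text{wall}}$ (prescribed) at $x_i=0$. The viscous contribution in the claim is the viscous part of the wall term on the right-hand side of the entropy inequality $\int_\Omega\partial_t\mathcal S\,dx\le-\int_{x_i=0}\left[w^\top\left(\nu\frac{dq}{dw}\right)\partial_{x_i}w-\mathcal F_i\right]dx_j\,dx_k$, where only the contribution of the wall is retained. *)

theory Defs
  imports "HOL-Analysis.Analysis"
begin

section \<open>Smooth functions and partial derivatives on sets that need not be open\<close>

text \<open>
  Derivatives are taken relative to the set \<open>S\<close> of space-time points, so that they are one-sided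
  at its boundary points (in particular the normal derivative at a wall). At interior points of
  \<open>S\<close> they are the usual derivatives.
\<close>

primrec Ck_on :: "nat \<Rightarrow> 'a set \<Rightarrow> ('a::euclidean_space \<Rightarrow> 'b::real_normed_vector) \<Rightarrow> bool" where
  "Ck_on 0 S f \<longleftrightarrow> continuous_on S f"
| "Ck_on (Suc n) S f \<longleftrightarrow> f differentiable_on S \<and>
     (\<forall>b\<in>Basis. Ck_on n S (\<lambda>z. frechet_derivative f (at z within S) b))"

definition smooth_on :: "'a set \<Rightarrow> ('a::euclidean_space \<Rightarrow> 'b::real_normed_vector) \<Rightarrow> bool" where
  "smooth_on S f \<longleftrightarrow> (\<forall>n. Ck_on n S f)"

type_synonym spacetime = "real \<times> (real^3)"

definition dt :: "spacetime set \<Rightarrow> (spacetime \<Rightarrow> 'b::real_normed_vector) \<Rightarrow> spacetime \<Rightarrow> 'b" where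
  "dt S f z = frechet_derivative f (at z within S) (1, 0)"

definition dx :: "spacetime set \<Rightarrow> 3 \<Rightarrow> (spacetime \<Rightarrow> 'b::real_normed_vector) \<Rightarrow> spacetime \<Rightarrow> 'b" where
  "dx S j f z = frechet_derivative f (at z within S) (0, axis j 1)"


section \<open>Conservative variables, entropy and entropy variables\<close>

text \<open>
  The five conservative variables form the triple \<open>(\<rho>, \<rho> U, \<rho> E)\<close> in the Euclidean space
  \<open>real \<times> (real^3) \<times> real\<close>, whose inner product is the one of five-dimensional space.
  The parameters \<open>cv\<close> and \<open>cp\<close> are the specific heats, the gas constant is \<open>R = cp - cv\<close>, and \<open>s0\<close>
  is the free additive constant of the thermodynamic entropy.
\<close>

type_synonym state = "real \<times> (real^3) \<times> real"

definition total_energy :: "real \<Rightarrow> real^3 \<Rightarrow> real \<Rightarrow> real" where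
  "total_energy cv U T = cv * T + (U \<bullet> U) / 2"

definition conservative :: "real \<Rightarrow> real \<Rightarrow> real^3 \<Rightarrow> real \<Rightarrow> state" where
  "conservative cv \<rho> U T = (\<rho>, \<rho> *\<^sub>R U, \<rho> * total_energy cv U T)"

definition mass_density :: "state \<Rightarrow> real" where
  "mass_density q = fst q"

definition velocity :: "state \<Rightarrow> real^3" where
  "velocity q = fst (snd q) /\<^sub>R fst q"

definition temperature :: "real \<Rightarrow> state \<Rightarrow> real" where
  "temperature cv q = (snd (snd q) / fst q - (velocity q \<bullet> velocity q) / 2) / cv"

definition admissible :: "real \<Rightarrow> state set" where
  "admissible cv = {q. mass_density q > 0 \<and> temperature cv q > 0}"

definition thermo_entropy :: "real \<Rightarrow> real \<Rightarrow> real \<Rightarrow> real \<Rightarrow> real \<Rightarrow> real" where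
  "thermo_entropy cv cp s0 \<rho> T = cv * ln T - (cp - cv) * ln \<rho> + s0"

definition entropy_fn :: "real \<Rightarrow> real \<Rightarrow> real \<Rightarrow> state \<Rightarrow> real" where
  "entropy_fn cv cp s0 q = - mass_density q * thermo_entropy cv cp s0 (mass_density q) (temperature cv q)"

definition entropy_vars :: "real \<Rightarrow> real \<Rightarrow> real \<Rightarrow> state \<Rightarrow> state" where
  "entropy_vars cv cp s0 q = (THE w. GDERIV (entropy_fn cv cp s0) q :> w)"

definition state_of_entropy_vars :: "real \<Rightarrow> real \<Rightarrow> real \<Rightarrow> state \<Rightarrow> state" where
  "state_of_entropy_vars cv cp s0 = the_inv_into (admissible cv) (entropy_vars cv cp s0)"

text \<open>The Jacobian of the conservative variables with respect to the entropy variables,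
  as a linear map.\<close>

definition dq_dw :: "real \<Rightarrow> real \<Rightarrow> real \<Rightarrow> state \<Rightarrow> state \<Rightarrow> state" where
  "dq_dw cv cp s0 w = frechet_derivative (state_of_entropy_vars cv cp s0) (at w)"

lemma has_derivative_fst_self: "(fst has_derivative fst) F"
  and has_derivative_snd_self: "(snd has_derivative snd) F"
  by (intro bounded_linear_imp_has_derivative bounded_linear_fst bounded_linear_snd)+

lemma has_derivative_fst_snd: "((\<lambda>q. fst (snd q)) has_derivative (\<lambda>h. fst (snd h))) F"
  and has_derivative_snd_snd: "((\<lambda>q. snd (snd q)) has_derivative (\<lambda>h. snd (snd h))) F"
  by (rule has_derivative_fst has_derivative_snd, rule has_derivative_snd_self)+

lemma has_derivative_inverse_fst:
  assumes "r > (0::real)"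
  shows "((\<lambda>q. inverse (fst q)) has_derivative (\<lambda>h. - (inverse r * fst h * inverse r))) (at (r, p))"
  using Deriv.has_derivative_inverse[OF _ has_derivative_fst_self, of "(r, p)" UNIV] assms by simp

lemma has_derivative_velocity:
  assumes r: "r > (0::real)"
  shows "(velocity has_derivative (\<lambda>h. (fst (snd h) - fst h *\<^sub>R velocity (r, m, e)) /\<^sub>R r)) (at (r, m, e))"
proof -
  have "((\<lambda>q::state. fst (snd q) /\<^sub>R fst q) has_derivative
      (\<lambda>h. fst (snd h) /\<^sub>R r - (inverse r * fst h * inverse r) *\<^sub>R m)) (at (r, m, e))"
    by (rule has_derivative_eq_rhs[OF has_derivative_scaleR
          [OF has_derivative_inverse_fst[OF r] has_derivative_fst_snd]]) simp
  moreover have "(\<lambda>h::state. fst (snd h) /\<^sub>R r - (inverse r * fst h * inverse r) *\<^sub>R m)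
    = (\<lambda>h. (fst (snd h) - fst h *\<^sub>R velocity (r, m, e)) /\<^sub>R r)"
    by (simp add: velocity_def scaleR_diff_right mult_ac)
  ultimately show ?thesis
    unfolding velocity_def[abs_def] by simp
qed

lemma has_derivative_temperature:
  fixes m :: "real^3" and e :: real
  assumes r: "r > (0::real)" and cv: "cv > 0"
  defines "U \<equiv> velocity (r, m, e)"
  defines "V \<equiv> \<lambda>h::state. (fst (snd h) - fst h *\<^sub>R U) /\<^sub>R r"
  shows "(temperature cv has_derivative
    (\<lambda>h. ((snd (snd h) - fst h * (e / r)) / r - U \<bullet> V h) / cv)) (at (r, m, e))"
proof -
  have V: "(velocity has_derivative V) (at (r, m, e))"
    unfolding V_def U_def using r by (rule has_derivative_velocity)
  have 1: "((\<lambda>q::state. snd (snd q) / fst q) has_derivative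
      (\<lambda>h. - e * (inverse r * fst h * inverse r) + snd (snd h) / r)) (at (r, m, e))"
    unfolding divide_inverse
    by (rule has_derivative_eq_rhs[OF has_derivative_mult
          [OF has_derivative_snd_snd has_derivative_inverse_fst[OF r]]]) simp
  have 2: "((\<lambda>q. (velocity q \<bullet> velocity q) / 2) has_derivative (\<lambda>h. U \<bullet> V h)) (at (r, m, e))"
    unfolding divide_inverse
    by (rule has_derivative_eq_rhs[OF has_derivative_mult_left[OF has_derivative_inner[OF V V]]])
      (simp add: U_def[symmetric] inner_commute)
  have 3: "((\<lambda>q. (snd (snd q) / fst q - (velocity q \<bullet> velocity q) / 2) / cv) has_derivative
      (\<lambda>h. (- e * (inverse r * fst h * inverse r) + snd (snd h) / r - U \<bullet> V h) / cv)) (at (r, m, e))"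
    unfolding divide_inverse[of _ cv]
    by (rule has_derivative_mult_left[OF has_derivative_diff[OF 1 2]])
  have "(\<lambda>h. (- e * (inverse r * fst h * inverse r) + snd (snd h) / r - U \<bullet> V h) / cv)
    = (\<lambda>h. ((snd (snd h) - fst h * (e / r)) / r - U \<bullet> V h) / cv)"
    by (rule ext) (simp add: divide_inverse algebra_simps)
  with 3 show ?thesis
    unfolding temperature_def[abs_def] by simp
qed

lemma GDERIV_entropy_fn:
  assumes cv: "cv > 0" and q: "q \<in> admissible cv"
  defines "\<rho> \<equiv> mass_density q" and "U \<equiv> velocity q" and "T \<equiv> temperature cv q"
  shows "GDERIV (entropy_fn cv cp s0) q :>
    (cp * T / T - thermo_entropy cv cp s0 \<rho> T - (U \<bullet> U) / (2 * T), U /\<^sub>R T, - 1 / T)"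
proof -
  obtain r m e where qe: "q = (r, m, e)" by (metis prod.collapse)
  have r: "r > 0" and T: "T > 0"
    using q by (auto simp: admissible_def mass_density_def T_def qe)
  define V where "V = (\<lambda>h::state. (fst (snd h) - fst h *\<^sub>R U) /\<^sub>R r)"
  define dT where "dT = (\<lambda>h::state. ((snd (snd h) - fst h * (e / r)) / r - U \<bullet> V h) / cv)"
  let ?D = "\<lambda>h. - fst h * thermo_entropy cv cp s0 r T - r * (cv * (dT h / T) - (cp - cv) * (fst h / r))"
  have dTd: "(temperature cv has_derivative dT) (at q)"
    unfolding dT_def V_def U_def qe by (rule has_derivative_temperature[OF r cv])
  have ln: "((\<lambda>q. ln (temperature cv q)) has_derivative (\<lambda>h. dT h / T)) (at q)"
           "((\<lambda>q::state. ln (fst q)) has_derivative (\<lambda>h. fst h / r)) (at q)"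
    using T has_derivative_ln[OF _ dTd] r has_derivative_ln[OF _ has_derivative_fst_self, where x=q]
    by (simp_all add: T_def qe divide_inverse mult_ac)
  have 1: "((\<lambda>q. cv * ln (temperature cv q) - (cp - cv) * ln (fst q) + s0) has_derivative
     (\<lambda>h. cv * (dT h / T) - (cp - cv) * (fst h / r))) (at q)"
    by (intro has_derivative_add_const has_derivative_diff has_derivative_mult_right ln)
  have "((\<lambda>q. - fst q * (cv * ln (temperature cv q) - (cp - cv) * ln (fst q) + s0)) has_derivative ?D) (at q)"
    by (rule has_derivative_eq_rhs,
        rule has_derivative_mult[OF has_derivative_minus[OF has_derivative_fst_self] 1])
      (auto simp: qe T_def thermo_entropy_def)
  then have "(entropy_fn cv cp s0 has_derivative ?D) (at q)"
    unfolding entropy_fn_def[abs_def] thermo_entropy_def[abs_def] mass_density_def .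
  moreover have "?D
    = (\<lambda>h. h \<bullet> (cp * T / T - thermo_entropy cv cp s0 \<rho> T - (U \<bullet> U) / (2 * T), U /\<^sub>R T, - 1 / T))"
  proof
    fix h :: state
    obtain a b c where h: "h = (a, b, c)" by (metis prod.collapse)
    have UV: "U \<bullet> V h = (U \<bullet> b - a * (U \<bullet> U)) / r"
      by (simp add: V_def h inner_diff_right divide_inverse)
    have rho: "\<rho> = r" by (simp add: \<rho>_def mass_density_def qe)
    have er: "e / r = cv * T + (U \<bullet> U) / 2"
      using cv by (simp add: T_def U_def temperature_def qe)
    have dTh: "dT h = (c - a * (cv * T + (U \<bullet> U) / 2) - (U \<bullet> b - a * (U \<bullet> U))) / (r * cv)"
      unfolding dT_def UV er by (simp add: h diff_divide_distrib)
    have dTr: "r * (cv * (dT h / T)) = (c - a * (cv * T + (U \<bullet> U) / 2) - (U \<bullet> b - a * (U \<bullet> U))) / T"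
      unfolding dTh using r cv by simp
    show "?D h
      = h \<bullet> (cp * T / T - thermo_entropy cv cp s0 \<rho> T - (U \<bullet> U) / (2 * T), U /\<^sub>R T, - 1 / T)"
      unfolding right_diff_distrib[of r] dTr using r T
      by (simp add: h rho inner_commute field_simps)
  qed
  ultimately show ?thesis by (simp only: gderiv_def)
qed

lemma entropy_vars_eq:
  assumes "cv > 0" "q \<in> admissible cv"
  defines "\<rho> \<equiv> mass_density q" and "U \<equiv> velocity q" and "T \<equiv> temperature cv q"
  shows "entropy_vars cv cp s0 q =
    (cp * T / T - thermo_entropy cv cp s0 \<rho> T - (U \<bullet> U) / (2 * T), U /\<^sub>R T, - 1 / T)"
proof -
  have "w = v" if "GDERIV f q :> w" "GDERIV f q :> v" for f :: "state \<Rightarrow> real" and w v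
  proof -
    have "(\<lambda>h. h \<bullet> w) = (\<lambda>h. h \<bullet> v)"
      using that has_derivative_unique unfolding gderiv_def by blast
    then show ?thesis by (metis vector_eq_ldot)
  qed
  then show ?thesis
    unfolding entropy_vars_def \<rho>_def U_def T_def
    using GDERIV_entropy_fn[OF assms(1,2)] by (intro the_equality) blast+
qed

lemma inj_on_entropy_vars:
  assumes cv: "cv > 0" and R: "cp - cv > 0"
  shows "inj_on (entropy_vars cv cp s0) (admissible cv)"
proof (rule inj_onI)
  fix p q assume p: "p \<in> admissible cv" and q: "q \<in> admissible cv"
    and eq: "entropy_vars cv cp s0 p = entropy_vars cv cp s0 q"
  have pos: "mass_density p > 0" "mass_density q > 0" "temperature cv p > 0" "temperature cv q > 0"
    using p q by (auto simp: admissible_def)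
  note e = eq[unfolded entropy_vars_eq[OF cv p] entropy_vars_eq[OF cv q], simplified]
  have T: "temperature cv p = temperature cv q" using e pos by simp
  have U: "velocity p = velocity q" using e pos T by simp
  have "ln (mass_density p) = ln (mass_density q)"
    using e pos T U R by (simp add: thermo_entropy_def)
  then have r: "mass_density p = mass_density q" using pos by simp
  have "fst (snd p) = fst (snd q)"
    using U r pos by (simp add: velocity_def mass_density_def)
  moreover have "snd (snd p) = snd (snd q)"
    using T U r pos cv by (simp add: temperature_def mass_density_def)
  ultimately show "p = q" using r by (simp add: mass_density_def prod_eq_iff)
qed


section \<open>The Eulerian model on the unit cube with a wall\<close>

definition unit_cube :: "(real^3) set" where
  "unit_cube = {x. \<forall>l. 0 < x $ l \<and> x $ l < 1}"

definition wall :: "3 \<Rightarrow> (real^3) set" where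
  "wall i = {x. x $ i = 0 \<and> (\<forall>l. l \<noteq> i \<longrightarrow> 0 < x $ l \<and> x $ l < 1)}"

text \<open>Smoothness is required up to the wall; nothing is required at the other faces.\<close>

definition flow_domain :: "real set \<Rightarrow> 3 \<Rightarrow> spacetime set" where
  "flow_domain I i = I \<times> (unit_cube \<union> wall i)"

definition eulerian_equations ::
  "real \<Rightarrow> real \<Rightarrow> (spacetime \<Rightarrow> real) \<Rightarrow> spacetime set \<Rightarrow>
   (spacetime \<Rightarrow> real) \<Rightarrow> (spacetime \<Rightarrow> real^3) \<Rightarrow> (spacetime \<Rightarrow> real) \<Rightarrow> spacetime \<Rightarrow> bool" where
  "eulerian_equations cv cp \<nu> S \<rho> U T z \<longleftrightarrow>
    (let p = (\<lambda>y. \<rho> y * (cp - cv) * T y);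
         E = (\<lambda>y. total_energy cv (U y) (T y));
         diffusion = (\<lambda>f::spacetime \<Rightarrow> real. \<Sum>j\<in>UNIV. dx S j (\<lambda>y. \<nu> y * dx S j f y) z)
     in dt S \<rho> z + (\<Sum>j\<in>UNIV. dx S j (\<lambda>y. \<rho> y * U y $ j) z) = diffusion \<rho>
      \<and> (\<forall>l. dt S (\<lambda>y. \<rho> y * U y $ l) z
             + (\<Sum>j\<in>UNIV. dx S j (\<lambda>y. \<rho> y * U y $ l * U y $ j) z) + dx S l p z
           = diffusion (\<lambda>y. \<rho> y * U y $ l))
      \<and> dt S (\<lambda>y. \<rho> y * E y) z + (\<Sum>j\<in>UNIV. dx S j (\<lambda>y. \<rho> y * E y * U y $ j) z)
           + (\<Sum>j\<in>UNIV. dx S j (\<lambda>y. p y * U y $ j) z)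
         = diffusion (\<lambda>y. \<rho> y * E y))"

text \<open>The viscosity \<open>\<mu>\<close> is a positive smooth field, which covers constant and
  temperature-dependent viscosities.\<close>

definition smooth_eulerian_solution ::
  "real \<Rightarrow> real \<Rightarrow> real \<Rightarrow> real set \<Rightarrow> 3 \<Rightarrow> (spacetime \<Rightarrow> real) \<Rightarrow>
   (spacetime \<Rightarrow> real) \<Rightarrow> (spacetime \<Rightarrow> real^3) \<Rightarrow> (spacetime \<Rightarrow> real) \<Rightarrow> bool" where
  "smooth_eulerian_solution cv cp \<alpha> I i \<mu> \<rho> U T \<longleftrightarrow>
    (let S = flow_domain I i in
      smooth_on S \<mu> \<and> smooth_on S \<rho> \<and> smooth_on S U \<and> smooth_on S T
      \<and> (\<forall>z\<in>S. \<mu> z > 0 \<and> \<rho> z > 0 \<and> T z > 0)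
      \<and> (\<forall>z\<in>I \<times> unit_cube. eulerian_equations cv cp (\<lambda>y. \<alpha> * \<mu> y / \<rho> y) S \<rho> U T z))"

definition no_slip :: "real set \<Rightarrow> 3 \<Rightarrow> (spacetime \<Rightarrow> real^3) \<Rightarrow> (spacetime \<Rightarrow> real^3) \<Rightarrow> bool" where
  "no_slip I i Uwall U \<longleftrightarrow>
    (\<forall>z\<in>I \<times> wall i. U z $ i = 0 \<and> (\<forall>l. l \<noteq> i \<longrightarrow> U z $ l = Uwall z $ l))"

definition viscous_wall_term ::
  "real \<Rightarrow> real \<Rightarrow> real \<Rightarrow> real \<Rightarrow> spacetime set \<Rightarrow> 3 \<Rightarrow> (spacetime \<Rightarrow> real) \<Rightarrow>
   (spacetime \<Rightarrow> real) \<Rightarrow> (spacetime \<Rightarrow> real^3) \<Rightarrow> (spacetime \<Rightarrow> real) \<Rightarrow> spacetime \<Rightarrow> real" where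
  "viscous_wall_term cv cp s0 \<alpha> S i \<mu> \<rho> U T z =
    (let \<nu> = \<alpha> * \<mu> z / \<rho> z;
         w = (\<lambda>y. entropy_vars cv cp s0 (conservative cv (\<rho> y) (U y) (T y)))
     in w z \<bullet> (\<nu> *\<^sub>R dq_dw cv cp s0 (w z) (dx S i w z)))"

definition wall_point :: "3 \<Rightarrow> 3 \<Rightarrow> real \<times> real \<Rightarrow> real^3" where
  "wall_point j k y = fst y *\<^sub>R axis j 1 + snd y *\<^sub>R axis k 1"

abbreviation unit_square :: "(real \<times> real) set" where
  "unit_square \<equiv> {0<..<1} \<times> {0<..<1}"

end

theory Submission
  imports Defs
begin

text \<open>
  The inner product with the entropy variables \<open>w = dS/dq\<close> undoes the change of variables in the
  viscous flux. By the chain rule \<open>(dq/dw) \<partial>\<^sub>i w = \<partial>\<^sub>i q\<close>, so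
  \<open>w \<bullet> (\<nu> (dq/dw) \<partial>\<^sub>i w) = \<nu> (dS/dq) \<partial>\<^sub>i q = \<nu> \<partial>\<^sub>i S\<close>:
  the viscous wall term is \<open>\<nu>\<close> times the normal derivative of the entropy \<open>S = - \<rho> s\<close> along the
  solution. With \<open>\<nu> = \<alpha> \<mu> / \<rho>\<close> and \<open>s = cv ln T - R ln \<rho> + s0\<close> this is
  \<open>- \<alpha> (cv (\<mu> / T) \<partial>\<^sub>i T + \<mu> (s - R) (1 / \<rho>) \<partial>\<^sub>i \<rho>)\<close> (lemma \<open>viscous_wall_term_eq\<close>).
  The condition on \<open>\<rho>\<close> removes the unbounded coefficient \<open>s - R\<close>, and the condition on \<open>T\<close>
  turns what is left into \<open>- \<alpha> cv g\<close>. Hence \<open>C = \<alpha> cv\<close> works, and the estimate is in fact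
  an equality.

  Two points need an argument beyond this computation. Derivatives are relative to a domain that is
  not open, so the chain rule determines \<open>\<partial>\<^sub>i\<close> only where such derivatives are unique; this is
  \<open>frechet_derivative_flow_domain\<close>. And \<open>dq/dw\<close> is the derivative of an inverse function, whose
  differentiability comes from the closed form \<open>explicit_state\<close>, valid on the open half space where
  the last entropy variable \<open>- 1 / T\<close> is negative.
\<close>

section \<open>Derivatives relative to the flow domain\<close>

lemma smooth_on_imp_differentiable_on: "smooth_on S f \<Longrightarrow> f differentiable_on S"
  by (metis smooth_on_def Ck_on.simps(2))

text \<open>
  A derivative relative to a set is determined once the set contains other points arbitrarily close to \<open>z\<close>
  along each coordinate axis. At a time that is an endpoint of \<open>I\<close>, and in the normal direction at
  the wall, only one sign of the increment is available, which suffices.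
\<close>

lemma frechet_derivative_flow_domain:
  fixes f :: "spacetime \<Rightarrow> 'b::real_normed_vector"
  assumes I: "is_interval I" "interior I \<noteq> {}" and z: "z \<in> flow_domain I i"
    and D: "(f has_derivative D) (at z within flow_domain I i)"
  shows "frechet_derivative f (at z within flow_domain I i) = D"
proof -
  let ?S = "flow_domain I i"
  obtain t x where zt: "z = (t, x)" and t: "t \<in> I" and x: "x \<in> unit_cube \<union> wall i"
    using z by (auto simp: flow_domain_def)
  have time: "\<exists>d. 0 < \<bar>d\<bar> \<and> \<bar>d\<bar> < e \<and> t + d \<in> I" if e: "e > 0" for e
  proof -
    \<comment> \<open>An interval with interior points has a point other than \<open>t\<close>; the increment moves towards it.\<close>
    have "I \<noteq> {t}" using I(2) by auto
    then obtain s where s: "s \<in> I" "s \<noteq> t" using t by auto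
    define r where "r = min (e / 2) \<bar>s - t\<bar>"
    have r: "0 < r" "r < e" "r \<le> \<bar>s - t\<bar>" using e s by (auto simp: r_def)
    have "t + (if s > t then r else - r) \<in> I"
    proof (cases "s > t")
      case True
      then show ?thesis using mem_is_interval_1_I[OF I(1) t s(1), of "t + r"] r by auto
    next
      case False
      then show ?thesis using mem_is_interval_1_I[OF I(1) s(1) t, of "t - r"] r by auto
    qed
    then show ?thesis using r by (intro exI[of _ "if s > t then r else - r"]) auto
  qed
  have space: "\<exists>d. 0 < \<bar>d\<bar> \<and> \<bar>d\<bar> < e \<and> x + d *\<^sub>R axis l 1 \<in> unit_cube \<union> wall i"
    if e: "e > 0" for e l
  proof -
    have l: "0 \<le> x $ l" "x $ l < 1"
      using x by (auto simp: unit_cube_def wall_def) (metis less_eq_real_def zero_less_one)+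
    \<comment> \<open>A small increase of a coordinate keeps a point of the cube inside it and moves a wall point
      into the cube or along the wall, so the step upwards is always available.\<close>
    define r where "r = min e (1 - x $ l) / 2"
    have r: "0 < r" "r < e" "x $ l + r < 1" using e l by (auto simp: r_def min_def field_simps)
    have "x + r *\<^sub>R axis l 1 \<in> unit_cube \<union> wall i"
      using x r l by (auto simp: unit_cube_def wall_def axis_def)
    then show ?thesis using r by (intro exI[of _ r]) auto
  qed
  have "\<exists>d. 0 < \<bar>d\<bar> \<and> \<bar>d\<bar> < e \<and> z + d *\<^sub>R b \<in> ?S" if e: "e > 0" and b: "b \<in> Basis" for e b
  proof -
    consider "b = (1, 0)" | l where "b = (0, axis l 1)"
      using b by (auto simp: Basis_prod_def Basis_vec_def)
    then show ?thesis
    proof cases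
      case 1
      then show ?thesis using time[OF e] x by (auto simp: zt flow_domain_def)
    next
      case 2
      then show ?thesis using space[OF e, of l] t by (auto simp: zt flow_domain_def)
    qed
  qed
  moreover have "(f has_derivative frechet_derivative f (at z within ?S)) (at z within ?S)"
    using D unfolding frechet_derivative_works[symmetric] differentiable_def by blast
  ultimately show ?thesis
    using D by (intro frechet_derivative_unique_within[of f _ z ?S]) auto
qed

section \<open>Conservative variables as a function of the entropy variables\<close>

lemma primitive_of_conservative:
  assumes "\<rho> > 0" "cv > 0"
  shows "mass_density (conservative cv \<rho> U T) = \<rho>"
    and "velocity (conservative cv \<rho> U T) = U"
    and "temperature cv (conservative cv \<rho> U T) = T"
  using assms
  by (simp_all add: mass_density_def velocity_def temperature_def conservative_def total_energy_def)

lemma conservative_admissible: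
  assumes "\<rho> > 0" "cv > 0" "T > 0"
  shows "conservative cv \<rho> U T \<in> admissible cv"
  using assms by (simp add: admissible_def primitive_of_conservative)

lemma entropy_vars_conservative:
  assumes "cv > 0" "\<rho> > 0" "T > 0"
  shows "entropy_vars cv cp s0 (conservative cv \<rho> U T) =
    (cp - (cv * ln T - (cp - cv) * ln \<rho> + s0) - (U \<bullet> U) / (2 * T), U /\<^sub>R T, - 1 / T)"
  using assms entropy_vars_eq[OF assms(1) conservative_admissible[OF assms(2,1,3)]]
  by (simp add: primitive_of_conservative thermo_entropy_def)

text \<open>
  From \<open>w = (cp - s - U\<^sup>2 / (2 T), U / T, - 1 / T)\<close> the last component gives \<open>T\<close>, the middle one
  \<open>U\<close>, and the first one \<open>s\<close> and thereby \<open>ln \<rho>\<close>.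
\<close>

definition explicit_state :: "real \<Rightarrow> real \<Rightarrow> real \<Rightarrow> state \<Rightarrow> state" where
  "explicit_state cv cp s0 w =
    (let T = - 1 / snd (snd w);
         U = T *\<^sub>R fst (snd w);
         \<rho> = exp ((fst w - cp + cv * ln T + s0 + (U \<bullet> U) / (2 * T)) / (cp - cv))
     in conservative cv \<rho> U T)"

lemma state_of_entropy_vars_eq_explicit:
  assumes cv: "cv > 0" and R: "cp - cv > 0" and w: "snd (snd w) < 0"
  shows "state_of_entropy_vars cv cp s0 w = explicit_state cv cp s0 w"
proof -
  obtain a b c where wabc: "w = (a, b, c)" by (metis prod.collapse)
  define T where "T = - 1 / c"
  define U where "U = T *\<^sub>R b"
  define \<rho> where "\<rho> = exp ((a - cp + cv * ln T + s0 + (U \<bullet> U) / (2 * T)) / (cp - cv))"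
  have T: "T > 0" using w by (simp add: T_def wabc divide_neg_neg)
  have \<rho>: "\<rho> > 0" by (simp add: \<rho>_def)
  have q: "explicit_state cv cp s0 w = conservative cv \<rho> U T"
    by (simp add: explicit_state_def wabc Let_def T_def U_def \<rho>_def)
  have "(cp - cv) * ln \<rho> = a - cp + cv * ln T + s0 + (U \<bullet> U) / (2 * T)"
    using R by (simp add: \<rho>_def)
  moreover have "U /\<^sub>R T = b" "- 1 / T = c"
    using T w by (simp_all add: U_def) (simp add: T_def wabc)
  ultimately have "entropy_vars cv cp s0 (explicit_state cv cp s0 w) = w"
    unfolding q entropy_vars_conservative[OF cv \<rho> T] by (simp add: wabc)
  moreover have "explicit_state cv cp s0 w \<in> admissible cv"
    unfolding q by (rule conservative_admissible[OF \<rho> cv T])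
  ultimately show ?thesis
    unfolding state_of_entropy_vars_def
    by (metis the_inv_into_f_f inj_on_entropy_vars[OF cv R])
qed

lemma explicit_state_differentiable:
  assumes w: "snd (snd w) < 0" and R: "cp - cv > 0"
  shows "explicit_state cv cp s0 differentiable at w"
proof -
  have c: "(\<lambda>w::state. snd (snd w)) differentiable at w" "(\<lambda>w::state. fst (snd w)) differentiable at w"
    "(fst :: state \<Rightarrow> real) differentiable at w"
    using has_derivative_snd_snd has_derivative_fst_snd has_derivative_fst_self
    unfolding differentiable_def by blast+
  have T: "(\<lambda>w::state. - 1 / snd (snd w)) differentiable at w"
    using w by (intro differentiable_divide c) auto
  have lnT: "(\<lambda>w::state. ln (- 1 / snd (snd w))) differentiable at w"
  proof -
    have "- 1 / snd (snd w) > 0" using w by (simp add: divide_neg_neg)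
    moreover obtain D where "((\<lambda>w::state. - 1 / snd (snd w)) has_derivative D) (at w)"
      using T unfolding differentiable_def by blast
    ultimately show ?thesis
      unfolding differentiable_def by (intro exI, rule has_derivative_ln)
  qed
  have e: "(\<lambda>x::state. exp (h x :: real)) differentiable at w" if "h differentiable at w" for h
    using that has_derivative_exp unfolding differentiable_def by blast
  show ?thesis
    unfolding explicit_state_def[abs_def] Let_def conservative_def total_energy_def
    using w R
    by (intro differentiable_Pair e differentiable_divide differentiable_add differentiable_diff differentiable_mult
        differentiable_scaleR differentiable_inner T lnT c) auto
qed

text \<open>
  Along a flow, \<open>q = G (w)\<close> with \<open>G\<close> the inverse of the entropy variables: this is the chain rule for
  \<open>G\<close>. Starting from a derivative of \<open>w\<close> avoids having to invert the Jacobian \<open>dw/dq\<close>.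
\<close>

lemma dq_dw_chain:
  assumes cv: "cv > 0" and R: "cp - cv > 0"
    and pos: "\<And>y. y \<in> S \<Longrightarrow> \<rho> y > 0 \<and> T y > 0" and z: "z \<in> S"
    and W: "((\<lambda>y. entropy_vars cv cp s0 (conservative cv (\<rho> y) (U y) (T y))) has_derivative W)
      (at z within S)"
  shows "((\<lambda>y. conservative cv (\<rho> y) (U y) (T y)) has_derivative
    (\<lambda>h. dq_dw cv cp s0 (entropy_vars cv cp s0 (conservative cv (\<rho> z) (U z) (T z))) (W h))) (at z within S)"
proof -
  let ?q = "\<lambda>y. conservative cv (\<rho> y) (U y) (T y)"
  let ?w = "\<lambda>y. entropy_vars cv cp s0 (?q y)"
  let ?G = "state_of_entropy_vars cv cp s0"
  have neg: "snd (snd (?w z)) < 0"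
    using pos[OF z] by (simp add: entropy_vars_conservative cv)
  have "open {w::state. snd (snd w) < 0}"
    by (intro open_Collect_less continuous_intros)
  then have "?G differentiable at (?w z)"
    using explicit_state_differentiable[OF neg R, of s0] neg
      has_derivative_transform_within_open[where f = "explicit_state cv cp s0" and g = ?G
        and s = "{w. snd (snd w) < 0}" and t = UNIV]
    unfolding differentiable_def
    by (metis (mono_tags, lifting) mem_Collect_eq state_of_entropy_vars_eq_explicit[OF cv R])
  then have "(?G has_derivative dq_dw cv cp s0 (?w z)) (at (?w z))"
    unfolding dq_dw_def by (simp add: frechet_derivative_works)
  from has_derivative_compose[OF W this]
  have "((\<lambda>y. ?G (?w y)) has_derivative (\<lambda>h. dq_dw cv cp s0 (?w z) (W h))) (at z within S)" .
  moreover have "?G (?w y) = ?q y" if "y \<in> S" for y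
    unfolding state_of_entropy_vars_def
    using pos[OF that] cv
    by (intro the_inv_into_f_f inj_on_entropy_vars[OF cv R] conservative_admissible) auto
  ultimately show ?thesis
    using has_derivative_transform[OF z] by (metis (no_types, lifting))
qed

section \<open>The viscous wall term\<close>

text \<open>
  The function \<open>- \<rho> s\<close> is differentiated along the flow in two ways: through \<open>w = dS/dq\<close>, which
  gives \<open>w \<bullet> \<partial>\<^sub>i q = w \<bullet> (dq/dw) \<partial>\<^sub>i w\<close>, and directly by the product rule. Uniqueness of
  derivatives relative to the domain equates the results.
\<close>

lemma viscous_wall_term_eq:
  assumes cv: "cv > 0" and R: "cp - cv > 0"
    and I: "is_interval I" "interior I \<noteq> {}" and z: "z \<in> flow_domain I i"
    and sol: "smooth_eulerian_solution cv cp \<alpha> I i \<mu> \<rho> U T"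
  defines "S \<equiv> flow_domain I i"
  shows "viscous_wall_term cv cp s0 \<alpha> S i \<mu> \<rho> U T z =
    - \<alpha> * (cv * (\<mu> z * (1 / T z) * dx S i T z)
      + \<mu> z * (thermo_entropy cv cp s0 (\<rho> z) (T z) - (cp - cv)) * (1 / \<rho> z * dx S i \<rho> z))"
proof -
  let ?F = "at z within S"
  let ?e = "(0, axis i 1) :: spacetime"
  let ?s = "\<lambda>y. thermo_entropy cv cp s0 (\<rho> y) (T y)"
  define q where "q = (\<lambda>y. conservative cv (\<rho> y) (U y) (T y))"
  define w where "w = (\<lambda>y. entropy_vars cv cp s0 (q y))"
  have zS: "z \<in> S" using z by (simp add: S_def)
  have pos: "\<rho> y > 0 \<and> T y > 0" if "y \<in> S" for y
    using sol that by (auto simp: smooth_eulerian_solution_def S_def Let_def)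
  note unique = frechet_derivative_flow_domain[OF I z, folded S_def]
  have diff: "\<rho> differentiable ?F" "U differentiable ?F" "T differentiable ?F"
    using sol zS smooth_on_imp_differentiable_on
    unfolding smooth_eulerian_solution_def S_def Let_def differentiable_on_def by blast+
  define r where "r = frechet_derivative \<rho> ?F"
  define \<theta> where "\<theta> = frechet_derivative T ?F"
  have r: "(\<rho> has_derivative r) ?F" and \<theta>: "(T has_derivative \<theta>) ?F"
    using diff by (simp_all add: r_def \<theta>_def frechet_derivative_works)
  have ln: "((\<lambda>y. ln (\<rho> y)) has_derivative (\<lambda>h. r h / \<rho> z)) ?F"
    "((\<lambda>y. ln (T y)) has_derivative (\<lambda>h. \<theta> h / T z)) ?F"
    using has_derivative_ln[OF _ r] has_derivative_ln[OF _ \<theta>] pos[OF zS]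
    by (simp_all add: divide_inverse mult.commute)
  have "(\<lambda>y. (cp - (cv * ln (T y) - (cp - cv) * ln (\<rho> y) + s0) - (U y \<bullet> U y) / (2 * T y),
      U y /\<^sub>R T y, - 1 / T y)) differentiable ?F"
  proof -
    have l: "(\<lambda>y. ln (\<rho> y)) differentiable ?F" "(\<lambda>y. ln (T y)) differentiable ?F"
      using ln unfolding differentiable_def by blast+
    show ?thesis
      using pos[OF zS]
      by (intro differentiable_Pair differentiable_divide differentiable_add differentiable_diff differentiable_mult
        differentiable_scaleR differentiable_inner differentiable_inverse l diff) auto
  qed
  then obtain W where "((\<lambda>y. (cp - (cv * ln (T y) - (cp - cv) * ln (\<rho> y) + s0) - (U y \<bullet> U y) / (2 * T y),
      U y /\<^sub>R T y, - 1 / T y)) has_derivative W) ?F"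
    unfolding differentiable_def by blast
  then have W: "(w has_derivative W) ?F"
    by (rule has_derivative_transform[OF zS, rotated])
      (simp add: w_def q_def entropy_vars_conservative cv pos)
  let ?Q = "\<lambda>h. dq_dw cv cp s0 (w z) (W h)"
  have Q: "(q has_derivative ?Q) ?F"
    using dq_dw_chain[where \<rho> = \<rho> and T = T and U = U, OF cv R pos zS W[unfolded w_def q_def]]
    unfolding w_def q_def .
  have "((\<lambda>y. entropy_fn cv cp s0 (q y)) has_derivative (\<lambda>h. ?Q h \<bullet> w z)) ?F"
  proof -
    have adm: "q z \<in> admissible cv"
      unfolding q_def using pos[OF zS] cv by (intro conservative_admissible) auto
    have "GDERIV (entropy_fn cv cp s0) (q z) :> w z"
      using GDERIV_entropy_fn[OF cv adm] unfolding w_def entropy_vars_eq[OF cv adm] .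
    then show ?thesis
      unfolding gderiv_def by (rule has_derivative_compose[OF Q])
  qed
  then have via_w: "((\<lambda>y. - \<rho> y * ?s y) has_derivative (\<lambda>h. ?Q h \<bullet> w z)) ?F"
    by (rule has_derivative_transform[OF zS, rotated])
      (simp add: entropy_fn_def q_def primitive_of_conservative cv pos)
  have direct: "((\<lambda>y. - \<rho> y * ?s y) has_derivative
      (\<lambda>h. - \<rho> z * (cv * (\<theta> h / T z) - (cp - cv) * (r h / \<rho> z)) + (- r h) * ?s z)) ?F"
    unfolding thermo_entropy_def
    by (intro has_derivative_mult has_derivative_minus has_derivative_add_const has_derivative_diff
        has_derivative_mult_right ln r)
  have "?Q ?e \<bullet> w z
      = - \<rho> z * (cv * (\<theta> ?e / T z) - (cp - cv) * (r ?e / \<rho> z)) + (- r ?e) * ?s z"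
    using fun_cong[OF trans[OF unique[OF via_w, symmetric] unique[OF direct]], of ?e] .
  moreover have "\<alpha> * m / a * (- a * (cv * (b / c) - (cp - cv) * (d / a)) + (- d) * s)
      = - \<alpha> * (cv * (m * (1 / c) * b) + m * (s - (cp - cv)) * (1 / a * d))"
    if "a > 0" "c > 0" for a b c d m s :: real
    using that by (simp add: field_simps)
  moreover have "dx S i w z = W ?e"
    unfolding dx_def unique[OF W] ..
  moreover have "dx S i T z = \<theta> ?e" "dx S i \<rho> z = r ?e"
    by (simp_all add: dx_def \<theta>_def r_def)
  moreover have "viscous_wall_term cv cp s0 \<alpha> S i \<mu> \<rho> U T z
      = \<alpha> * \<mu> z / \<rho> z * (dq_dw cv cp s0 (w z) (dx S i w z) \<bullet> w z)"
    unfolding viscous_wall_term_def Let_def w_def q_def by (simp add: inner_commute)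
  ultimately show ?thesis
    using pos[OF zS] by (simp only:)
qed

lemma wall_point_in_wall:
  assumes jk: "{j, k} = UNIV - {i}" and y: "y \<in> unit_square"
  shows "wall_point j k y \<in> wall i"
proof -
  have "card {j, k} = 2" unfolding jk by (simp add: card_Diff_singleton)
  then have "j \<noteq> k" by auto
  moreover have "l = j \<or> l = k" if "l \<noteq> i" for l
    using jk that by blast
  moreover have "i \<noteq> j" "i \<noteq> k" using jk by blast+
  ultimately show ?thesis
    using y by (auto simp: wall_def wall_point_def axis_def)
qed

lemma unit_square_measure: "emeasure lborel unit_square = 1"
  unfolding lborel_prod[symmetric] by (simp add: lborel.emeasure_pair_measure_Times)

theorem theorem3:
  fixes cv cp \<alpha> :: real
  assumes "cv > 0" and "cp - cv > 0" and "1 \<le> \<alpha>" and "\<alpha> \<le> 4 / 3"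
  shows "\<exists>C. \<forall>(s0::real) (i::3) (j::3) (k::3) (I::real set)
      (\<mu>::spacetime \<Rightarrow> real) (\<rho>::spacetime \<Rightarrow> real) (U::spacetime \<Rightarrow> real^3) (T::spacetime \<Rightarrow> real)
      (Uwall::spacetime \<Rightarrow> real^3) (g::real \<Rightarrow> real).
    {j, k} = UNIV - {i} \<longrightarrow>
    is_interval I \<longrightarrow> interior I \<noteq> {} \<longrightarrow>
    smooth_eulerian_solution cv cp \<alpha> I i \<mu> \<rho> U T \<longrightarrow>
    no_slip I i Uwall U \<longrightarrow>
    (\<forall>t\<in>I. \<forall>x\<in>wall i.
       \<mu> (t, x) * (1 / T (t, x)) * dx (flow_domain I i) i T (t, x) = g t \<and>
       1 / \<rho> (t, x) * dx (flow_domain I i) i \<rho> (t, x) = 0) \<longrightarrow>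
    (\<forall>t\<in>I.
       set_integrable lborel unit_square
         (\<lambda>y. viscous_wall_term cv cp s0 \<alpha> (flow_domain I i) i \<mu> \<rho> U T (t, wall_point j k y)) \<and>
       \<bar>- (LINT y:unit_square|lborel.
           viscous_wall_term cv cp s0 \<alpha> (flow_domain I i) i \<mu> \<rho> U T (t, wall_point j k y))\<bar>
         \<le> C * (LINT y:unit_square|lborel. \<bar>g t\<bar>))"
proof (intro exI[of _ "\<alpha> * cv"] allI impI ballI)
  fix s0 :: real and i j k :: 3 and I :: "real set" and \<mu> \<rho> T :: "spacetime \<Rightarrow> real"
    and U Uwall :: "spacetime \<Rightarrow> real^3" and g :: "real \<Rightarrow> real" and t :: real
  assume jk: "{j, k} = UNIV - {i}" and I: "is_interval I" "interior I \<noteq> {}"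
    and sol: "smooth_eulerian_solution cv cp \<alpha> I i \<mu> \<rho> U T"
    and bc: "\<forall>t\<in>I. \<forall>x\<in>wall i.
       \<mu> (t, x) * (1 / T (t, x)) * dx (flow_domain I i) i T (t, x) = g t \<and>
       1 / \<rho> (t, x) * dx (flow_domain I i) i \<rho> (t, x) = 0"
    and t: "t \<in> I"
  let ?v = "\<lambda>y. viscous_wall_term cv cp s0 \<alpha> (flow_domain I i) i \<mu> \<rho> U T (t, wall_point j k y)"
  have v: "?v y = - \<alpha> * cv * g t" if "y \<in> unit_square" for y
  proof -
    have x: "wall_point j k y \<in> wall i" by (rule wall_point_in_wall[OF jk that])
    then have z: "(t, wall_point j k y) \<in> flow_domain I i" using t by (simp add: flow_domain_def)
    have bc': "\<mu> (t, wall_point j k y) * (1 / T (t, wall_point j k y))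
          * dx (flow_domain I i) i T (t, wall_point j k y) = g t"
        "1 / \<rho> (t, wall_point j k y) * dx (flow_domain I i) i \<rho> (t, wall_point j k y) = 0"
      using bc t x by blast+
    show ?thesis
      unfolding viscous_wall_term_eq[OF assms(1,2) I z sol] bc' by simp
  qed
  have meas: "unit_square \<in> sets lborel" by (simp add: open_Times borel_open)
  have const: "set_integrable lborel unit_square (\<lambda>y. c)"
    "(LINT y:unit_square|lborel. c) = c" for c :: real
    using unit_square_measure meas
    by (auto simp: set_integrable_def set_lebesgue_integral_def measure_def)
  have "set_integrable lborel unit_square ?v \<longleftrightarrow>
      set_integrable lborel unit_square (\<lambda>y. - \<alpha> * cv * g t)"
    by (rule set_integrable_cong) (simp_all add: v)
  moreover have "(LINT y:unit_square|lborel. ?v y) = (LINT y:unit_square|lborel. - \<alpha> * cv * g t)"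
    using meas v by (intro set_lebesgue_integral_cong) auto
  ultimately show "set_integrable lborel unit_square ?v \<and>
      \<bar>- (LINT y:unit_square|lborel. ?v y)\<bar> \<le> \<alpha> * cv * (LINT y:unit_square|lborel. \<bar>g t\<bar>)"
    using assms(1,3) by (simp add: const abs_mult)
qed

end
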